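(* Let $\widehat{\beta}_n(t)$ be the functional difference-in-differences estimator $$\widehat{\beta}_n(t)=\left(\frac1n\sum_{i=1}^n \dot D_i^2\right)^{-1}\left(\frac1n\sum_{i=1}^n \dot D_i\,(\dot Y_i(t)-\dot Y_i(-1))\right),$$ and let $\widehat{\beta}^{PD}_n=(\widehat{\beta}^{PD}_{n,t})_{t\in\{-T_{pre},\dots,T_{post}\}}$ be the panel data two-way fixed effects estimator (augmented by $\widehat\beta^{PD}_{n,-1}=0$) defined in the context. Then $$\widehat{\beta}_n(t)=\widehat{\beta}^{PD}_{n,t}\quad\text{for every } t\in\{-T_{pre},\dots,T_{post}\},\qquad\text{with } \widehat{\beta}_n(-1)=\widehat{\beta}^{PD}_{n,-1}=0.$$
   Context: $T_{pre},T_{post}$ are positive integers, $T:=T_{pre}+T_{post}+1$. For units $i=1,\dots,n$ we have a treatment indicator $D_i\in\{0,1\}$ and an outcome process $Y_i=\{Y_i(t):t\in[-T_{pre},T_{post}]\}$, with panel observations $Y_{it}=Y_i(t)$ for $t\in\{-T_{pre},\dots,T_{post}\}$. Time $t=-1$ is the reference period. Notation: $\dot D_i=D_i-n^{-1}\sum_{j=1}^n D_j$, $\dot Y_i(t)=Y_i(t)-n^{-1}\sum_{j=1}^nY_j(t)$. The estimators are defined when $\sum_i\dot D_i^2\neq0$. Panel estimator: for $s\in\{-T_{pre},\dots,T_{post}\}\setminus\{-1\}$ let $D_{its}:=D_i\,\mathbf 1\{t=s\}$. For a panel array $(A_{it})$ define the two-way transformation $$\ddot A^{PD}_{it}=A_{it}-\frac1T\sum_{r=-T_{pre}}^{T_{post}}A_{ir}-\frac1n\sum_{j=1}^nA_{jt}+\frac1{nT}\sum_{j=1}^n\sum_{r=-T_{pre}}^{T_{post}}A_{jr}.$$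 Apply it to $Y_{it}$ and, for each fixed $s$, to $D_{its}$, giving $\ddot Y^{PD}_{it}$ and $\ddot D^{PD}_{its}$ (written $\ddot D^{PD}_{it,s}$). Put $\ddot D^{PD}_{it}=(\ddot D^{PD}_{it,-T_{pre}},\dots,\ddot D^{PD}_{it,-2},\ddot D^{PD}_{it,0},\dots,\ddot D^{PD}_{it,T_{post}})^\top\in\mathbb R^{T-1}$. The $(T-1)$-dimensional estimator is $$\left(\frac1{nT}\sum_{i=1}^n\sum_{t=-T_{pre}}^{T_{post}}\ddot D^{PD}_{it}\ddot D^{PD\,\top}_{it}\right)^{-1}\left(\frac1{nT}\sum_{i=1}^n\sum_{t=-T_{pre}}^{T_{post}}\ddot D^{PD}_{it}\ddot Y^{PD}_{it}\right),$$ with entries indexed by $t\in\{-T_{pre},\dots,T_{post}\}\setminus\{-1\}$; inserting the value $0$ at index $t=-1$ gives $\widehat\beta^{PD}_n=(\widehat\beta^{PD}_{n,-T_{pre}},\dots,\widehat\beta^{PD}_{n,-2},0,\widehat\beta^{PD}_{n,0},\dots,\widehat\beta^{PD}_{n,T_{post}})^\top$. *)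

theory Defs
  imports Complex_Main "Jordan_Normal_Form.Gauss_Jordan_Elimination"
begin

text \<open>
  The units are \<open>1, \<dots>, n\<close>.  An outcome process is a function of real time, of which only the values
  on \<open>[-Tpre, Tpost]\<close> matter; a panel array is indexed by a unit and an integer period.
\<close>

definition demean :: "nat \<Rightarrow> (nat \<Rightarrow> real) \<Rightarrow> nat \<Rightarrow> real" where
  "demean n X i = X i - (1 / real n) * (\<Sum>j = 1..n. X j)"

definition beta_fd :: "nat \<Rightarrow> (nat \<Rightarrow> real) \<Rightarrow> (nat \<Rightarrow> real \<Rightarrow> real) \<Rightarrow> real \<Rightarrow> real" where
  "beta_fd n D Y t =
     inverse ((1 / real n) * (\<Sum>i = 1..n. (demean n D i)\<^sup>2)) *
     ((1 / real n) * (\<Sum>i = 1..n. demean n D i *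
        (demean n (\<lambda>j. Y j t) i - demean n (\<lambda>j. Y j (-1)) i)))"

definition n_periods :: "nat \<Rightarrow> nat \<Rightarrow> nat" where
  "n_periods Tpre Tpost = Tpre + Tpost + 1"

definition periods :: "nat \<Rightarrow> nat \<Rightarrow> int set" where
  "periods Tpre Tpost = {- int Tpre..int Tpost}"

definition two_way :: "nat \<Rightarrow> nat \<Rightarrow> nat \<Rightarrow> (nat \<Rightarrow> int \<Rightarrow> real) \<Rightarrow> nat \<Rightarrow> int \<Rightarrow> real" where
  "two_way n Tpre Tpost A i t =
     A i t
     - (1 / real (n_periods Tpre Tpost)) * (\<Sum>r \<in> periods Tpre Tpost. A i r)
     - (1 / real n) * (\<Sum>j = 1..n. A j t)
     + (1 / (real n * real (n_periods Tpre Tpost))) *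
       (\<Sum>j = 1..n. \<Sum>r \<in> periods Tpre Tpost. A j r)"

definition treat_dummy :: "(nat \<Rightarrow> real) \<Rightarrow> int \<Rightarrow> nat \<Rightarrow> int \<Rightarrow> real" where
  "treat_dummy D s i t = D i * (if t = s then 1 else 0)"

text \<open>
  Vectors and matrices have positions \<open>0, \<dots>, T - 2\<close>.  \<open>event_time\<close> lists the periods
  \<open>-Tpre, \<dots>, -2, 0, \<dots>, Tpost\<close> in increasing order and \<open>event_pos\<close> is its inverse
  (see \<open>bij_betw_event_time\<close> and \<open>event_pos_event_time\<close> below).
\<close>

definition event_time :: "nat \<Rightarrow> nat \<Rightarrow> int" where
  "event_time Tpre k = (if k + 1 < Tpre then int k - int Tpre else int k - int Tpre + 1)"

definition event_pos :: "nat \<Rightarrow> int \<Rightarrow> nat" where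
  "event_pos Tpre s = nat (if s < -1 then s + int Tpre else s + int Tpre - 1)"

lemma event_pos_event_time: "Tpre > 0 \<Longrightarrow> event_pos Tpre (event_time Tpre k) = k"
  by (auto simp: event_pos_def event_time_def)

lemma bij_betw_event_time:
  assumes "Tpre > 0"
  shows "bij_betw (event_time Tpre) {..<n_periods Tpre Tpost - 1} (periods Tpre Tpost - {-1})"
  by (rule bij_betw_byWitness[where f' = "event_pos Tpre"])
    (use assms in \<open>auto simp: event_pos_def event_time_def n_periods_def periods_def split: if_splits\<close>)

definition regressor :: "nat \<Rightarrow> nat \<Rightarrow> nat \<Rightarrow> (nat \<Rightarrow> real) \<Rightarrow> nat \<Rightarrow> int \<Rightarrow> real vec" where
  "regressor n Tpre Tpost D i t =
     vec (n_periods Tpre Tpost - 1)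
       (\<lambda>k. two_way n Tpre Tpost (treat_dummy D (event_time Tpre k)) i t)"

text \<open>The average of the outer products of the regressor vectors, written entrywise.\<close>

definition gram_PD :: "nat \<Rightarrow> nat \<Rightarrow> nat \<Rightarrow> (nat \<Rightarrow> real) \<Rightarrow> real mat" where
  "gram_PD n Tpre Tpost D =
     mat (n_periods Tpre Tpost - 1) (n_periods Tpre Tpost - 1)
       (\<lambda>(k, l). (1 / (real n * real (n_periods Tpre Tpost))) *
          (\<Sum>i = 1..n. \<Sum>t \<in> periods Tpre Tpost.
             regressor n Tpre Tpost D i t $ k * regressor n Tpre Tpost D i t $ l))"

definition moment_PD ::
  "nat \<Rightarrow> nat \<Rightarrow> nat \<Rightarrow> (nat \<Rightarrow> real) \<Rightarrow> (nat \<Rightarrow> real \<Rightarrow> real) \<Rightarrow> real vec" where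
  "moment_PD n Tpre Tpost D Y =
     vec (n_periods Tpre Tpost - 1)
       (\<lambda>k. (1 / (real n * real (n_periods Tpre Tpost))) *
          (\<Sum>i = 1..n. \<Sum>t \<in> periods Tpre Tpost.
             regressor n Tpre Tpost D i t $ k *
             two_way n Tpre Tpost (\<lambda>j r. Y j (real_of_int r)) i t))"

text \<open>\<open>mat_inverse\<close> returns \<open>None\<close> on singular matrices, so \<open>coef_PD\<close> is meaningful only if
  \<open>gram_PD\<close> is invertible.\<close>

definition coef_PD ::
  "nat \<Rightarrow> nat \<Rightarrow> nat \<Rightarrow> (nat \<Rightarrow> real) \<Rightarrow> (nat \<Rightarrow> real \<Rightarrow> real) \<Rightarrow> real vec" where
  "coef_PD n Tpre Tpost D Y =
     the (mat_inverse (gram_PD n Tpre Tpost D)) *\<^sub>v moment_PD n Tpre Tpost D Y"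

definition beta_PD ::
  "nat \<Rightarrow> nat \<Rightarrow> nat \<Rightarrow> (nat \<Rightarrow> real) \<Rightarrow> (nat \<Rightarrow> real \<Rightarrow> real) \<Rightarrow> int \<Rightarrow> real" where
  "beta_PD n Tpre Tpost D Y t =
     (if t = -1 then 0 else coef_PD n Tpre Tpost D Y $ event_pos Tpre t)"

end

theory Submission
  imports Defs "Jordan_Normal_Form.Determinant"
begin

text \<open>
  The two-way transformed dummy of period \<open>s\<close> is the product of the demeaned treatment indicator
  and \<open>1{t = s} - 1/T\<close>.  Hence, with \<open>Q\<close> the sum of squares of the demeaned indicators, the Gram
  matrix is \<open>Q / (n T)\<close> times \<open>I - J / T\<close>, where \<open>J\<close> is the all-ones matrix of dimension \<open>T - 1\<close>.
  Its inverse is \<open>n T / Q\<close> times \<open>I + J\<close>.  With \<open>c t\<close> the sum over units of the demeaned indicator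
  times the demeaned outcome at \<open>t\<close>, the moment vector has entries \<open>(c s - mean c) / (n T)\<close>, and the
  normal equations are solved by \<open>(c s - c (-1)) / Q\<close>, which is the functional estimator at \<open>s\<close>.
\<close>

text \<open>Serves twice: with \<open>P\<close> the set of periods, for the transformed dummies, and
  with \<open>P\<close> the positions \<open>{..<m}\<close>, for the rows of the Gram
  matrix.\<close>

lemma sum_centered_indicator_mult:
  fixes f :: "'a \<Rightarrow> real"
  assumes "finite P" and "s \<in> P"
  shows "(\<Sum>t\<in>P. ((if t = s then 1 else 0) - c) * f t) = f s - c * sum f P"
proof -
  have "(\<Sum>t\<in>P. ((if t = s then 1 else 0) - c) * f t)
      = (\<Sum>t\<in>P. (if t = s then f t else 0) - c * f t)"
    by (rule sum.cong) (auto simp: algebra_simps)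
  also have "\<dots> = f s - c * sum f P"
    using assms by (simp add: sum_subtractf sum_distrib_left)
  finally show ?thesis .
qed

section \<open>Periods and their enumeration without the reference period\<close>

lemma finite_periods [simp]: "finite (periods Tpre Tpost)"
  by (simp add: periods_def)

lemma card_periods [simp]: "card (periods Tpre Tpost) = n_periods Tpre Tpost"
  by (simp add: periods_def n_periods_def)

lemma n_periods_pos [simp]: "n_periods Tpre Tpost > 0"
  by (simp add: n_periods_def)

lemma event_time_mem:
  assumes "Tpre > 0" and "k < n_periods Tpre Tpost - 1"
  shows "event_time Tpre k \<in> periods Tpre Tpost"
  using bij_betw_event_time[OF assms(1), of Tpost] assms(2) by (auto simp: bij_betw_def)

lemma event_pos_less:
  assumes "Tpre > 0" and "t \<in> periods Tpre Tpost" and "t \<noteq> -1"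
  shows "event_pos Tpre t < n_periods Tpre Tpost - 1"
  using assms by (auto simp: event_pos_def periods_def n_periods_def)

lemma event_time_event_pos:
  assumes "Tpre > 0" and "t \<in> periods Tpre Tpost" and "t \<noteq> -1"
  shows "event_time Tpre (event_pos Tpre t) = t"
  using assms by (auto simp: event_pos_def event_time_def periods_def)

lemma event_time_eq_iff:
  assumes "Tpre > 0"
  shows "event_time Tpre k = event_time Tpre l \<longleftrightarrow> k = l"
  by (metis assms event_pos_event_time)

text \<open>Since \<open>f\<close> vanishes at the reference period, that period can be put back
  into the sum for free.\<close>

lemma sum_event_time:
  fixes f :: "int \<Rightarrow> real"
  assumes "Tpre > 0" and "f (-1) = 0"
  shows "(\<Sum>k<n_periods Tpre Tpost - 1. f (event_time Tpre k)) = sum f (periods Tpre Tpost)"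
proof -
  have "(\<Sum>k<n_periods Tpre Tpost - 1. f (event_time Tpre k))
      = sum f (periods Tpre Tpost - {-1})"
    by (rule sum.reindex_bij_betw[OF bij_betw_event_time[OF assms(1)]])
  also have "\<dots> = sum f (periods Tpre Tpost)"
    using assms(2) by (intro sum.mono_neutral_left) auto
  finally show ?thesis .
qed

section \<open>The two-way transformation\<close>

text \<open>Averaging over units commutes with averaging over periods, so the transformation amounts
  to demeaning over units followed by demeaning over time.\<close>

lemma two_way_eq_centered_demean:
  "two_way n Tpre Tpost A i t = demean n (\<lambda>j. A j t) i
     - (1 / real (n_periods Tpre Tpost)) * (\<Sum>r\<in>periods Tpre Tpost. demean n (\<lambda>j. A j r) i)"
proof -
  have "(\<Sum>r\<in>periods Tpre Tpost. \<Sum>j = 1..n. A j r)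
      = (\<Sum>j = 1..n. \<Sum>r\<in>periods Tpre Tpost. A j r)"
    by (rule sum.swap)
  then show ?thesis
    by (simp add: two_way_def demean_def sum_subtractf sum_divide_distrib [symmetric]
        diff_divide_distrib)
qed

lemma sum_two_way_periods: "(\<Sum>t\<in>periods Tpre Tpost. two_way n Tpre Tpost A i t) = 0"
  by (simp add: two_way_eq_centered_demean sum_subtractf)

text \<open>The dummy is a unit factor times a time factor, and each of the two demeanings acts on
  its own factor. As \<open>s\<close> is a period, the indicator has time average 1/T.\<close>

lemma two_way_treat_dummy:
  assumes "s \<in> periods Tpre Tpost"
  shows "two_way n Tpre Tpost (treat_dummy D s) i t
     = demean n D i * ((if t = s then 1 else 0) - 1 / real (n_periods Tpre Tpost))"
proof -
  have "demean n (\<lambda>j. treat_dummy D s j r) i = (if r = s then demean n D i else 0)" for r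
    by (simp add: treat_dummy_def demean_def)
  then show ?thesis
    using assms by (simp add: two_way_eq_centered_demean algebra_simps)
qed

text \<open>The transformed \<open>A\<close> sums to zero over time, so the -1/T in the dummy
  contributes nothing and the indicator picks out \<open>t = s\<close>. Taking \<open>A\<close> to
  be a dummy gives the Gram matrix, taking it to be the outcome gives the moments.\<close>

lemma sum_treat_dummy_mult_two_way:
  assumes "s \<in> periods Tpre Tpost"
  shows "(\<Sum>t\<in>periods Tpre Tpost.
        two_way n Tpre Tpost (treat_dummy D s) i t * two_way n Tpre Tpost A i t)
     = demean n D i * two_way n Tpre Tpost A i s"
  using assms
  by (simp add: two_way_treat_dummy mult.assoc sum_distrib_left [symmetric]
      sum_centered_indicator_mult sum_two_way_periods)

section \<open>Entries of the Gram matrix and of the moment vector\<close>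

text \<open>The time sum collapses to the dummy of position \<open>l\<close> evaluated at the period
  of position \<open>k\<close>; injectivity of \<open>event_time\<close> turns equality of periods
  into \<open>k = l\<close>.\<close>

lemma gram_PD_index:
  assumes "Tpre > 0" and "k < n_periods Tpre Tpost - 1" and "l < n_periods Tpre Tpost - 1"
  shows "gram_PD n Tpre Tpost D $$ (k, l)
     = (\<Sum>i = 1..n. (demean n D i)\<^sup>2) / (real n * real (n_periods Tpre Tpost))
       * ((if k = l then 1 else 0) - 1 / real (n_periods Tpre Tpost))"
proof -
  let ?T = "real (n_periods Tpre Tpost)"
  have "gram_PD n Tpre Tpost D $$ (k, l)
      = 1 / (real n * ?T) * (\<Sum>i = 1..n. demean n D i *
          two_way n Tpre Tpost (treat_dummy D (event_time Tpre l)) i (event_time Tpre k))"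
    using assms(2,3) event_time_mem[OF assms(1,2)]
    by (simp add: gram_PD_def regressor_def sum_treat_dummy_mult_two_way)
  also have "\<dots> = 1 / (real n * ?T) * (\<Sum>i = 1..n. (demean n D i)\<^sup>2 *
      ((if k = l then 1 else 0) - 1 / ?T))"
    using event_time_mem[OF assms(1,3)]
    by (simp only: two_way_treat_dummy event_time_eq_iff[OF assms(1)] power2_eq_square mult.assoc)
  finally show ?thesis
    by (simp only: sum_distrib_right [symmetric]) simp
qed

lemma moment_PD_index:
  fixes D :: "nat \<Rightarrow> real" and Y :: "nat \<Rightarrow> real \<Rightarrow> real" and n :: nat
  assumes "Tpre > 0" and "k < n_periods Tpre Tpost - 1"
  defines "c \<equiv> \<lambda>t. \<Sum>i = 1..n. demean n D i * demean n (\<lambda>j. Y j (real_of_int t)) i"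
  shows "moment_PD n Tpre Tpost D Y $ k
     = (c (event_time Tpre k) - sum c (periods Tpre Tpost) / real (n_periods Tpre Tpost))
       / (real n * real (n_periods Tpre Tpost))"
proof -
  let ?P = "periods Tpre Tpost" and ?T = "real (n_periods Tpre Tpost)"
  let ?Z = "\<lambda>i t. demean n (\<lambda>j. Y j (real_of_int t)) i"
  have "sum c ?P = (\<Sum>i = 1..n. demean n D i * (\<Sum>t\<in>?P. ?Z i t))"
    unfolding c_def sum_distrib_left by (rule sum.swap)
  \<comment> \<open>The weights \<open>demean n D i\<close> do not depend on time, so centering
    \<open>c\<close> over time means centering each \<open>?Z i\<close>.\<close>
  then have c: "c s - sum c ?P / ?T
      = (\<Sum>i = 1..n. demean n D i * (?Z i s - 1 / ?T * (\<Sum>t\<in>?P. ?Z i t)))" for s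
    by (simp add: c_def right_diff_distrib sum_subtractf sum_divide_distrib [symmetric])
  have "moment_PD n Tpre Tpost D Y $ k
      = 1 / (real n * ?T) * (\<Sum>i = 1..n. demean n D i *
          two_way n Tpre Tpost (\<lambda>j r. Y j (real_of_int r)) i (event_time Tpre k))"
    using assms(2) event_time_mem[OF assms(1,2)]
    by (simp add: moment_PD_def regressor_def sum_treat_dummy_mult_two_way)
  then show ?thesis
    by (simp add: c two_way_eq_centered_demean)
qed

lemma beta_fd_eq:
  assumes "(\<Sum>i = 1..n. (demean n D i)\<^sup>2) \<noteq> 0"
  shows "beta_fd n D Y t
     = ((\<Sum>i = 1..n. demean n D i * demean n (\<lambda>j. Y j t) i)
        - (\<Sum>i = 1..n. demean n D i * demean n (\<lambda>j. Y j (-1)) i))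
       / (\<Sum>i = 1..n. (demean n D i)\<^sup>2)"
proof -
  \<comment> \<open>For \<open>n = 0\<close> the sum of squares would be empty, hence zero.\<close>
  have "n \<noteq> 0"
    using assms by (intro notI) simp
  then show ?thesis
    using assms by (simp add: beta_fd_def right_diff_distrib sum_subtractf field_simps)
qed

section \<open>Invertibility and the normal equations\<close>

text \<open>Guarantees that \<open>coef_PD\<close> does not rest on \<open>the None\<close>.\<close>

lemma invertible_gram_PD:
  assumes "Tpre > 0" and "(\<Sum>i = 1..n. (demean n D i)\<^sup>2) \<noteq> 0"
  shows "invertible_mat (gram_PD n Tpre Tpost D)"
proof -
  define m where "m = n_periods Tpre Tpost - 1"
  define Q where "Q = (\<Sum>i = 1..n. (demean n D i)\<^sup>2)"
  define T where "T = real (n_periods Tpre Tpost)"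
  define G where "G = gram_PD n Tpre Tpost D"
  \<comment> \<open>I + J inverts I - J/T because J^2 = (T - 1) J in dimension T - 1. In dimension
    T, with the reference period kept, I - J/T would annihilate the all-ones vector.\<close>
  define H where "H = mat m m (\<lambda>(k, l). real n * T / Q * ((if k = l then 1 else 0) + 1))"
  have T: "T > 0" "real m = T - 1"
    by (simp_all add: T_def m_def n_periods_def)
  have Q: "Q \<noteq> 0"
    using assms(2) by (simp add: Q_def)
  have n: "n \<noteq> 0"
    using assms(2) by (intro notI) simp
  have G: "G \<in> carrier_mat m m" and H: "H \<in> carrier_mat m m"
    by (simp_all add: G_def H_def gram_PD_def m_def)
  have Gi: "G $$ (k, l) = Q / (real n * T) * ((if k = l then 1 else 0) - 1 / T)"
    if "k < m" "l < m" for k l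
    using that gram_PD_index[OF assms(1)] by (simp add: G_def Q_def T_def m_def)
  have GH: "G * H = 1\<^sub>m m"
  proof (rule eq_matI)
    fix k l assume "k < dim_row (1\<^sub>m m)" "l < dim_col (1\<^sub>m m)"
    then have kl: "k < m" "l < m" by auto
    have "(G * H) $$ (k, l) = (\<Sum>p<m. G $$ (k, p) * H $$ (p, l))"
      using kl G H by (auto simp: scalar_prod_def atLeast0LessThan intro!: sum.cong)
    also have "\<dots> = (\<Sum>p<m. ((if p = k then 1 else 0) - 1 / T) * ((if p = l then 1 else 0) + 1))"
      using kl T Q n by (intro sum.cong) (auto simp: Gi H_def)
    also have "\<dots> = (if k = l then 1 else 0) + 1 - 1 / T * (1 + real m)"
      using kl by (subst sum_centered_indicator_mult) (auto simp: sum.distrib)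
    also have "\<dots> = (1\<^sub>m m :: real mat) $$ (k, l)"
      using kl T by simp
    finally show "(G * H) $$ (k, l) = 1\<^sub>m m $$ (k, l)" .
  qed (use G H in auto)
  moreover have "H * G = 1\<^sub>m m"
    by (rule mat_mult_left_right_inverse[OF G H GH])
  ultimately show ?thesis
    using G H unfolding invertible_mat_def inverts_mat_def G_def [symmetric] by auto
qed

lemma gram_PD_mult_beta_fd:
  assumes "Tpre > 0" and "(\<Sum>i = 1..n. (demean n D i)\<^sup>2) \<noteq> 0"
  shows "gram_PD n Tpre Tpost D *\<^sub>v
      vec (n_periods Tpre Tpost - 1) (\<lambda>k. beta_fd n D Y (real_of_int (event_time Tpre k)))
    = moment_PD n Tpre Tpost D Y"
proof -
  define m where "m = n_periods Tpre Tpost - 1"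
  define Q where "Q = (\<Sum>i = 1..n. (demean n D i)\<^sup>2)"
  define T where "T = real (n_periods Tpre Tpost)"
  define G where "G = gram_PD n Tpre Tpost D"
  define c where "c t = (\<Sum>i = 1..n. demean n D i * demean n (\<lambda>j. Y j (real_of_int t)) i)" for t
  define b where "b t = (c t - c (-1)) / Q" for t
  have T: "T > 0"
    by (simp add: T_def)
  have Q: "Q \<noteq> 0"
    using assms(2) by (simp add: Q_def)
  have beta: "beta_fd n D Y (real_of_int t) = b t" for t
    using beta_fd_eq[OF assms(2)] by (simp add: b_def c_def Q_def)
  have G: "G \<in> carrier_mat m m"
    by (simp add: G_def gram_PD_def m_def)
  have Gi: "G $$ (k, l) = Q / (real n * T) * ((if k = l then 1 else 0) - 1 / T)"
    if "k < m" "l < m" for k l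
    using that gram_PD_index[OF assms(1)] by (simp add: G_def Q_def T_def m_def)
  \<comment> \<open>The factor of \<open>c (-1)\<close> is T although there are only T - 1 summands:
    \<open>b (-1) = 0\<close> extends the sum to all periods.\<close>
  have b_sum: "(\<Sum>l<m. b (event_time Tpre l)) = (sum c (periods Tpre Tpost) - T * c (-1)) / Q"
    unfolding m_def using sum_event_time[OF assms(1), of b]
    by (simp add: b_def sum_divide_distrib [symmetric] sum_subtractf T_def)
  have "(G *\<^sub>v vec m (\<lambda>k. b (event_time Tpre k))) $ k = moment_PD n Tpre Tpost D Y $ k"
    if k: "k < m" for k
  proof -
    have "(G *\<^sub>v vec m (\<lambda>k. b (event_time Tpre k))) $ k
        = (\<Sum>l<m. G $$ (k, l) * b (event_time Tpre l))"
      using k G by (auto simp: scalar_prod_def atLeast0LessThan intro!: sum.cong)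
    also have "\<dots> = Q / (real n * T)
        * (\<Sum>l<m. ((if l = k then 1 else 0) - 1 / T) * b (event_time Tpre l))"
      unfolding sum_distrib_left using k by (intro sum.cong) (auto simp: Gi)
    also have "\<dots> = Q / (real n * T)
        * (b (event_time Tpre k) - 1 / T * (\<Sum>l<m. b (event_time Tpre l)))"
      using k by (subst sum_centered_indicator_mult) auto
    \<comment> \<open>The reference value \<open>c (-1)\<close> cancels here, thanks to the factor T
      in \<open>b_sum\<close>.\<close>
    also have "b (event_time Tpre k) - 1 / T * (\<Sum>l<m. b (event_time Tpre l))
        = (c (event_time Tpre k) - sum c (periods Tpre Tpost) / T) / Q"
      unfolding b_sum b_def [of "event_time Tpre k"] using T Q by (simp add: field_simps)
    also have "Q / (real n * T) * \<dots> = moment_PD n Tpre Tpost D Y $ k"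
      using k Q moment_PD_index[OF assms(1), of k Tpost n D Y]
      by (simp add: c_def [abs_def] T_def m_def)
    finally show ?thesis .
  qed
  then show ?thesis
    unfolding G_def [symmetric] m_def [symmetric] beta
    using G by (intro eq_vecI) (auto simp: moment_PD_def m_def)
qed

text \<open>A two-sided inverse makes \<open>A\<close> a unit of \<open>ring_mat\<close>, and on
  units \<open>mat_inverse\<close> cannot return \<open>None\<close>.\<close>

lemma the_mat_inverse_mult:
  fixes A :: "'a :: field mat"
  assumes A: "A \<in> carrier_mat m m" and "invertible_mat A"
  shows "the (mat_inverse A) \<in> carrier_mat m m" and "the (mat_inverse A) * A = 1\<^sub>m m"
proof -
  obtain B where B: "A * B = 1\<^sub>m m" "B * A = 1\<^sub>m (dim_row B)"
    using assms unfolding invertible_mat_def inverts_mat_def by auto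
  \<comment> \<open>\<open>invertible_mat\<close> leaves the dimensions of the inverse open; they
    are read off from the column counts of the two products.\<close>
  have "dim_col B = m" "dim_row B = m"
    using arg_cong[OF B(1), of dim_col] arg_cong[OF B(2), of dim_col] A by auto
  then have "A \<in> Units (ring_mat TYPE('a) m ())"
    using A B unfolding Units_def ring_mat_def by auto
  then obtain C where "mat_inverse A = Some C"
    using mat_inverse(1)[OF A, of "()"] by (cases "mat_inverse A") auto
  then show "the (mat_inverse A) \<in> carrier_mat m m" "the (mat_inverse A) * A = 1\<^sub>m m"
    using mat_inverse(2)[OF A] by auto
qed

lemma coef_PD_eq:
  assumes "Tpre > 0" and "(\<Sum>i = 1..n. (demean n D i)\<^sup>2) \<noteq> 0"
  shows "coef_PD n Tpre Tpost D Y
    = vec (n_periods Tpre Tpost - 1) (\<lambda>k. beta_fd n D Y (real_of_int (event_time Tpre k)))"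
    (is "_ = ?b")
proof -
  let ?m = "n_periods Tpre Tpost - 1"
  let ?G = "gram_PD n Tpre Tpost D"
  have G: "?G \<in> carrier_mat ?m ?m"
    by (simp add: gram_PD_def)
  note inv = the_mat_inverse_mult[OF G invertible_gram_PD[OF assms]]
  have "coef_PD n Tpre Tpost D Y = the (mat_inverse ?G) *\<^sub>v (?G *\<^sub>v ?b)"
    by (simp only: coef_PD_def gram_PD_mult_beta_fd[OF assms])
  also have "\<dots> = (the (mat_inverse ?G) * ?G) *\<^sub>v ?b"
    using inv(1) G by (intro assoc_mult_mat_vec[symmetric]) auto
  also have "\<dots> = ?b"
    unfolding inv(2) by simp
  finally show ?thesis .
qed

theorem theorem2p2:
  fixes n Tpre Tpost :: nat
    and D :: "nat \<Rightarrow> real"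
    and Y :: "nat \<Rightarrow> real \<Rightarrow> real"
  assumes "Tpre > 0" and "Tpost > 0"
    and "\<And>i. i \<in> {1..n} \<Longrightarrow> D i \<in> {0, 1}"
    and "(\<Sum>i = 1..n. (demean n D i)\<^sup>2) \<noteq> 0"
  shows "invertible_mat (gram_PD n Tpre Tpost D)
    \<and> (\<forall>t \<in> periods Tpre Tpost. beta_fd n D Y (real_of_int t) = beta_PD n Tpre Tpost D Y t)
    \<and> beta_fd n D Y (-1) = beta_PD n Tpre Tpost D Y (-1)
    \<and> beta_PD n Tpre Tpost D Y (-1) = 0"
proof -
  \<comment> \<open>The functional estimator vanishes because its outcome differences are zero at
    the reference time, the panel one by its augmentation.\<close>
  have ref: "beta_fd n D Y (-1) = 0" "beta_PD n Tpre Tpost D Y (-1) = 0"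
    by (simp_all add: beta_fd_def beta_PD_def)
  have "beta_fd n D Y (real_of_int t) = beta_PD n Tpre Tpost D Y t"
    if "t \<in> periods Tpre Tpost" for t
  proof (cases "t = -1")
    case True
    then show ?thesis using ref by simp
  next
    case False
    then show ?thesis
      using event_pos_less[OF assms(1) that] event_time_event_pos[OF assms(1) that]
      by (simp add: beta_PD_def coef_PD_eq[OF assms(1,4)])
  qed
  then show ?thesis
    using ref invertible_gram_PD[OF assms(1,4)] by simp
qed

end
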